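(* Let $r\ge 2$ and $0<\rho<\pi/r$ be fixed. Consider the class of sets $\mathcal{S}=\{s_1,\dots,s_r\}$ of $r$ segments with uniform arc-radius $\rho$, $$s_i=[\cos(\tau_i+\rho),\cos(\tau_i-\rho)],\quad i\in\{1,\dots,r\},\qquad \rho\le\tau_1<\dots<\tau_r\le\pi-\rho,$$ so that all arc-midpoints $\cos\tau_i$ lie in $I_\rho=[-\cos\rho,\cos\rho]$. Then the Fekete segments $\mathcal{S}^{\mathrm{Fek}}$ in this class, i.e. those that maximize the absolute value $|\det V^{\mathfrak{U}}(\mathcal{S})|$ of the determinant of the normalized Vandermonde matrix, have the arc-midpoints $$\cos\tau_i^{\mathrm{Fek}}=\xi_i^{(LL)}\cos\rho,\qquad i\in\{1,\dots,r\},$$ where $\xi_i^{(LL)}$, $i\in\{1,\dots,r\}$, are the Legendre-Gauss-Lobatto nodes of order $r$ in $[-1,1]$, numbered in decreasing order.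
   Context: Let $\mathfrak{U}=\{U_0,\dots,U_{r-1}\}$ be the basis of Chebyshev polynomials of the second kind, $U_{j-1}(x)=\frac{\sin(j\arccos x)}{\sin(\arccos x)}$, of the space of polynomials of degree at most $r-1$. The normalized Vandermonde matrix of $\mathcal{S}=\{s_1,\dots,s_r\}$ with respect to $\mathfrak{U}$ is the $r\times r$ matrix with entries $V^{\mathfrak{U}}_{i,j}(\mathcal{S})=\frac{1}{|s_i|}\int_{s_i}U_{j-1}(x)\,dx$, where $|s_i|$ is the length of $s_i$. The Legendre-Gauss-Lobatto nodes of order $r$ are the $r$ roots of $(1-x^2)P_{r-1}'(x)$, where $P_{r-1}$ is the Legendre polynomial of degree $r-1$. *)

theory Defs
  imports
    "HOL-Analysis.Analysis"
    "HOL-Computational_Algebra.Polynomial"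
    "Jordan_Normal_Form.Determinant"
begin

fun chebyshev_U :: "nat \<Rightarrow> real poly" where
  "chebyshev_U 0 = 1"
| "chebyshev_U (Suc 0) = [:0, 2:]"
| "chebyshev_U (Suc (Suc n)) = [:0, 2:] * chebyshev_U (Suc n) - chebyshev_U n"

lemma chebyshev_U_cos:
  "poly (chebyshev_U n) (cos t) * sin t = sin (real (Suc n) * t)"
proof (induction n rule: chebyshev_U.induct)
  case 1
  then show ?case by simp
next
  case 2
  then show ?case by (simp add: sin_double)
next
  case (3 n)
  have "sin (real (Suc (Suc (Suc n))) * t) + sin (real (Suc n) * t)
      = 2 * cos t * sin (real (Suc (Suc n)) * t)"
    using sin_add[of "real (Suc (Suc n)) * t" t] sin_diff[of "real (Suc (Suc n)) * t" t]
    by (simp add: algebra_simps)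
  with 3 show ?case
    by (simp add: left_diff_distrib mult.assoc)
qed

text \<open>The trigonometric formula determines each of these polynomials. It is stated on the open
  interval because its quotient is \<open>0 / 0\<close> at \<open>\<plusminus>1\<close>.\<close>
lemma chebyshev_U_arccos:
  assumes "-1 < x" "x < 1"
  shows "poly (chebyshev_U n) x = sin (real (Suc n) * arccos x) / sin (arccos x)"
proof -
  have "sin (arccos x) > 0"
    using assms arccos_lt_bounded[of x] by (intro sin_gt_zero) auto
  then show ?thesis
    using chebyshev_U_cos[of n "arccos x"] assms by (simp add: field_simps)
qed

text \<open>Rodrigues' formula\<close>
definition legendre_poly :: "nat \<Rightarrow> real poly" where
  "legendre_poly n = Polynomial.smult (1 / (2 ^ n * fact n)) ((pderiv ^^ n) ([:-1, 0, 1:] ^ n))"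

definition lgl_nodes :: "nat \<Rightarrow> real set" where
  "lgl_nodes r = {x. poly ([:1, 0, -1:] * pderiv (legendre_poly (r - 1))) x = 0}"

text \<open>The nodes in decreasing order, numbered from \<open>1\<close>.\<close>
definition lgl_node :: "nat \<Rightarrow> nat \<Rightarrow> real" where
  "lgl_node r i = rev (sorted_list_of_set (lgl_nodes r)) ! (i - 1)"

text \<open>Segments are numbered from \<open>1\<close>, matrix rows and columns from \<open>0\<close>; so column \<open>j\<close> here belongs
  to \<open>chebyshev_U j\<close>, whose degree is \<open>j\<close>.\<close>
definition normalized_vandermonde :: "nat \<Rightarrow> (nat \<Rightarrow> real set) \<Rightarrow> real mat" where
  "normalized_vandermonde r s =
    mat r r (\<lambda>(i, j). 1 / measure lborel (s (Suc i)) * integral (s (Suc i)) (poly (chebyshev_U j)))"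

definition arc_segment :: "real \<Rightarrow> real \<Rightarrow> real set" where
  "arc_segment \<rho> \<tau> = {cos (\<tau> + \<rho>)..cos (\<tau> - \<rho>)}"

definition admissible_midpoints :: "nat \<Rightarrow> real \<Rightarrow> (nat \<Rightarrow> real) \<Rightarrow> bool" where
  "admissible_midpoints r \<rho> \<tau> \<longleftrightarrow> \<rho> \<le> \<tau> 1 \<and> strict_mono_on {1..r} \<tau> \<and> \<tau> r \<le> pi - \<rho>"

text \<open>The family \<open>s\<^sub>i = arc_segment \<rho> (\<tau> i)\<close> is represented by the angles \<open>\<tau>\<close>.\<close>
definition fekete_segments :: "nat \<Rightarrow> real \<Rightarrow> (nat \<Rightarrow> real) \<Rightarrow> bool" where
  "fekete_segments r \<rho> \<tau> \<longleftrightarrow>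
    is_arg_max (\<lambda>\<tau>'. \<bar>Determinant.det (normalized_vandermonde r (\<lambda>i. arc_segment \<rho> (\<tau>' i)))\<bar>)
      (admissible_midpoints r \<rho>) \<tau>"

end

theory Submission
  imports Defs
begin

text \<open>
  Substituting \<open>x = cos t\<close> turns the integral of \<open>U\<^sub>j\<close> over \<open>s\<^sub>i\<close> into an integral of
  \<open>sin ((j + 1) t)\<close>, so the \<open>(i, j)\<close> entry of the matrix is
  \<open>sin ((j + 1) \<rho>) / ((j + 1) sin \<rho>) * U\<^sub>j (cos \<tau>\<^sub>i)\<close>, and the first factor is nonzero because
  \<open>\<rho> < \<pi> / r\<close>. Up to a constant the determinant is therefore the Vandermonde determinant of the
  arc-midpoints, and the Fekete segments correspond to the classical Fekete points of
  \<open>[- cos \<rho>, cos \<rho>]\<close>. After rescaling to \<open>[-1, 1]\<close>, moving one point at a time shows that the two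
  extreme points are \<open>\<plusminus>1\<close> and that \<open>w = \<Prod>\<^sub>j (x - y\<^sub>j)\<close> satisfies \<open>w'' = 0\<close> at the interior points.
  Hence \<open>(1 - x\<^sup>2) w'' + r (r - 1) w\<close> has degree less than \<open>r\<close> and \<open>r\<close> zeros, so it vanishes.
  The polynomial \<open>(1 - x\<^sup>2) P'\<close>, with \<open>P\<close> the Legendre polynomial of degree \<open>r - 1\<close>, solves the same
  equation, whose polynomial solutions are unique up to a factor.
\<close>

subsection \<open>The differential equation of the Lobatto polynomial\<close>

text \<open>The operator links only degrees of equal parity and multiplies a leading coefficient of
  degree \<open>m\<close> by \<open>- m * (m - 1)\<close>.\<close>

lemma coeff_legendre_operator:
  fixes p :: "real poly"
  shows "coeff ([:1, 0, -1:] * pderiv (pderiv p)) m =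
    (real m + 1) * (real m + 2) * coeff p (m + 2) - real m * (real m - 1) * coeff p m"
proof -
  have "[:1, 0, -1:] * s = s - pCons 0 (pCons 0 s)" for s :: "real poly"
    by simp
  then show ?thesis
    by (auto simp: coeff_pderiv coeff_pCons algebra_simps split: nat.split)
qed

text \<open>Leading coefficients force \<open>d * (d - 1) = r * (r - 1)\<close> for the degree
  \<open>d\<close>, and the other root \<open>1 - r\<close> is negative.\<close>

lemma lobatto_ode_degree:
  fixes p :: "real poly"
  assumes "p \<noteq> 0" "r \<ge> 2"
    and ode: "[:1, 0, -1:] * pderiv (pderiv p) = Polynomial.smult (- (real r * (real r - 1))) p"
  shows "degree p = r"
proof -
  define d where "d = degree p"
  have "coeff p d \<noteq> 0"
    using assms(1) by (simp add: d_def)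
  moreover have "coeff p (d + 2) = 0"
    by (simp add: d_def coeff_eq_0)
  moreover have "(real d + 1) * (real d + 2) * coeff p (d + 2) - real d * (real d - 1) * coeff p d
      = - (real r * (real r - 1)) * coeff p d"
    using arg_cong[OF ode, of "\<lambda>q. coeff q d"] unfolding coeff_legendre_operator by simp
  ultimately have "real d * (real d - 1) = real r * (real r - 1)"
    by simp
  then have "(real d - real r) * (real d + real r - 1) = 0"
    by (simp add: algebra_simps)
  moreover have "real d + real r - 1 > 0"
    using assms(2) by linarith
  ultimately show ?thesis
    by (simp add: d_def)
qed

text \<open>The combination that cancels the coefficient of degree \<open>r\<close> solves the same
  equation, but a nonzero solution has degree exactly \<open>r\<close>.\<close>

lemma lobatto_ode_unique:
  fixes p q :: "real poly"
  assumes "r \<ge> 2"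
    and p: "[:1, 0, -1:] * pderiv (pderiv p) = Polynomial.smult (- (real r * (real r - 1))) p"
    and q: "[:1, 0, -1:] * pderiv (pderiv q) = Polynomial.smult (- (real r * (real r - 1))) q"
  shows "Polynomial.smult (coeff q r) p = Polynomial.smult (coeff p r) q"
proof -
  define u where "u = Polynomial.smult (coeff q r) p - Polynomial.smult (coeff p r) q"
  have "[:1, 0, -1:] * pderiv (pderiv u) = Polynomial.smult (coeff q r) ([:1, 0, -1:] * pderiv (pderiv p))
      - Polynomial.smult (coeff p r) ([:1, 0, -1:] * pderiv (pderiv q))"
    unfolding u_def pderiv_diff pderiv_smult right_diff_distrib mult_smult_right ..
  also have "\<dots> = Polynomial.smult (- (real r * (real r - 1))) u"
    unfolding p q u_def by (simp add: smult_diff_right mult.commute)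
  finally have "u = 0 \<or> degree u = r"
    using lobatto_ode_degree[of u r] assms(1) by blast
  moreover have "coeff u r = 0"
    by (simp add: u_def)
  ultimately have "u = 0"
    by auto
  then show ?thesis
    by (simp add: u_def)
qed

text \<open>Leibniz' rule applied \<open>k + 1\<close> times to
  \<open>(x^2 - 1) f' = 2 n x f\<close>, where \<open>f = (x^2 - 1)^n\<close>; the induction takes
  one derivative at a time.\<close>

lemma rodrigues_ode:
  fixes n k :: nat
  defines "D \<equiv> \<lambda>k. (pderiv ^^ k) ([:-1, 0, 1:] ^ n :: real poly)"
  shows "[:-1, 0, 1:] * D (Suc (Suc k)) + [:0, 2 * (real k + 1):] * D (Suc k)
      + Polynomial.smult (real k * (real k + 1)) (D k)
    = [:0, 2 * real n:] * D (Suc k) + Polynomial.smult (2 * real n * (real k + 1)) (D k)"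
proof (induction k)
  have [simp]: "pderiv (D k) = D (Suc k)" for k
    by (simp add: D_def)
  {
    case 0
    have "[:-1, 0, 1:] * D 1 = [:0, 2 * real n:] * D 0"
    proof (cases n)
      case (Suc m)
      then have "D 1 = Polynomial.smult (real n) ([:-1, 0, 1:] ^ m * pderiv [:-1, 0, 1:])"
        by (simp add: D_def pderiv_power del: power_Suc)
      then have "[:-1, 0, 1:] * D 1 = [:-1, 0, 1:] * [:-1, 0, 1:] ^ m * Polynomial.smult (real n) (pderiv [:-1, 0, 1:])"
        by (simp only: mult_smult_right mult.assoc)
      also have "\<dots> = D 0 * Polynomial.smult (real n) (pderiv [:-1, 0, 1:])"
        by (simp only: D_def Suc power_Suc funpow_0)
      also have "Polynomial.smult (real n) (pderiv [:-1, 0, 1:]) = [:0, 2 * real n:]"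
        by (simp add: pderiv_pCons)
      finally show ?thesis
        by (simp only: mult.commute)
    qed (simp add: D_def)
    from arg_cong[OF this, of pderiv, unfolded pderiv_mult] show ?case
      by (simp add: pderiv_pCons poly_eq_poly_eq_iff[symmetric] fun_eq_iff algebra_simps
          del: mult_pCons_left)
  next
    case (Suc k)
    from arg_cong[OF Suc, of pderiv, unfolded pderiv_add pderiv_mult pderiv_smult] show ?case
      by (simp add: pderiv_pCons poly_eq_poly_eq_iff[symmetric] fun_eq_iff algebra_simps
          del: mult_pCons_left)
  }
qed

text \<open>Legendre's equation in self-adjoint form. It is the case \<open>k = n\<close> of
  \<open>rodrigues_ode\<close>, where the terms in \<open>D (Suc n)\<close> combine to the factor
  \<open>2 * x\<close>.\<close>

lemma legendre_poly_ode:
  "pderiv ([:1, 0, -1:] * pderiv (legendre_poly n))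
    = Polynomial.smult (- (real n * (real n + 1))) (legendre_poly n)"
proof -
  define P where "P = legendre_poly n"
  define c where "c = 1 / (2 ^ n * fact n :: real)"
  define D where "D = (\<lambda>k. (pderiv ^^ k) ([:-1, 0, 1:] ^ n :: real poly))"
  have "P = Polynomial.smult c (D n)"
    by (simp add: P_def legendre_poly_def c_def D_def)
  moreover have "pderiv (D k) = D (Suc k)" for k
    by (simp add: D_def)
  ultimately have P: "poly P x = c * poly (D n) x" "poly (pderiv P) x = c * poly (D (Suc n)) x"
      "poly (pderiv (pderiv P)) x = c * poly (D (Suc (Suc n))) x" for x
    by (simp_all add: pderiv_smult)
  have ode: "[:-1, 0, 1:] * D (Suc (Suc n)) + [:0, 2 * (real n + 1):] * D (Suc n)
      + Polynomial.smult (real n * (real n + 1)) (D n)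
    = [:0, 2 * real n:] * D (Suc n) + Polynomial.smult (2 * real n * (real n + 1)) (D n)"
    unfolding D_def by (rule rodrigues_ode)
  have "(x\<^sup>2 - 1) * poly (pderiv (pderiv P)) x + 2 * x * poly (pderiv P) x
      = real n * (real n + 1) * poly P x" for x
    using arg_cong[OF ode, of "\<lambda>p. c * poly p x"]
    unfolding P by (simp add: algebra_simps power2_eq_square del: mult_pCons_left)
  then show ?thesis
    unfolding P_def[symmetric] pderiv_mult
    by (simp add: pderiv_pCons poly_eq_poly_eq_iff[symmetric] fun_eq_iff
        algebra_simps power2_eq_square del: mult_pCons_left)
qed

lemma degree_legendre_poly: "degree (legendre_poly n) = n"
proof -
  have "degree ((pderiv ^^ k) p) = degree p - k" for k and p :: "real poly"
    by (induction k) (auto simp: degree_pderiv)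
  then show ?thesis
    by (simp add: legendre_poly_def degree_power_eq)
qed

text \<open>For \<open>W = (1 - x^2) P'\<close> Legendre's equation reads
  \<open>W' = - r (r - 1) P\<close>. Differentiating and multiplying by \<open>1 - x^2\<close> shows
  that \<open>W\<close> solves the equation of \<open>w\<close>, so the two are proportional and
  share their roots.\<close>

lemma lgl_nodes_eq_roots:
  fixes w :: "real poly"
  assumes "r \<ge> 2" "coeff w r \<noteq> 0"
    and ode: "[:1, 0, -1:] * pderiv (pderiv w) = Polynomial.smult (- (real r * (real r - 1))) w"
  shows "lgl_nodes r = {x. poly w x = 0}"
proof -
  define W where "W = [:1, 0, -1:] * pderiv (legendre_poly (r - 1))"
  have "pderiv (pderiv W) = Polynomial.smult (- (real r * (real r - 1))) (pderiv (legendre_poly (r - 1)))"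
    using assms(1) unfolding W_def legendre_poly_ode by (simp add: pderiv_smult pderiv_minus of_nat_diff mult.commute)
  then have W: "[:1, 0, -1:] * pderiv (pderiv W) = Polynomial.smult (- (real r * (real r - 1))) W"
    unfolding W_def by (simp only: mult_smult_right)
  have "W \<noteq> 0"
    using assms(1) by (simp add: W_def pderiv_eq_0_iff degree_legendre_poly del: mult_pCons_left)
  with lobatto_ode_degree[OF _ assms(1) W] have "coeff W r \<noteq> 0"
    by auto
  moreover have "coeff w r * poly W x = coeff W r * poly w x" for x
    using arg_cong[OF lobatto_ode_unique[OF assms(1) W ode], of "\<lambda>p. poly p x"] by simp
  ultimately have "poly W x = 0 \<longleftrightarrow> poly w x = 0" for x
    using assms(2) by (metis mult_eq_0_iff)
  then show ?thesis
    by (simp add: lgl_nodes_def W_def del: mult_pCons_left)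
qed

subsection \<open>Fekete points of \<open>[-1, 1]\<close>\<close>

lemma inj_on_if_decreasing:
  fixes x :: "nat \<Rightarrow> 'a :: linorder"
  assumes "\<And>i j. i < j \<Longrightarrow> j < r \<Longrightarrow> x j < x i"
  shows "inj_on x {..<r}"
  using assms by (metis (no_types, lifting) inj_onI lessThan_iff nat_neq_iff order_less_irrefl)

lemma node_poly:
  fixes y :: "nat \<Rightarrow> real"
  assumes "finite A"
  defines "w \<equiv> \<Prod>j\<in>A. [:- y j, 1:]"
  shows "degree w = card A" "coeff w (card A) = 1" "poly w x = (\<Prod>j\<in>A. x - y j)"
proof -
  show deg: "degree w = card A"
    unfolding w_def by (subst degree_prod_sum_eq) auto
  have "lead_coeff w = 1"
    unfolding w_def lead_coeff_prod by simp
  with deg show "coeff w (card A) = 1"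
    by simp
  show "poly w x = (\<Prod>j\<in>A. x - y j)"
    by (simp add: w_def poly_prod)
qed

text \<open>Fermat's criterion for the smooth function \<open>F^2\<close> gives
  \<open>2 F F' = 0\<close>, and \<open>F\<close> is nonzero at the point.\<close>

lemma poly_local_max_abs_imp_critical:
  fixes F :: "real poly"
  assumes "poly F x \<noteq> 0" "d > 0"
    and "\<And>t. \<bar>x - t\<bar> < d \<Longrightarrow> \<bar>poly F t\<bar> \<le> \<bar>poly F x\<bar>"
  shows "poly (pderiv F) x = 0"
proof -
  have "poly (pderiv (F\<^sup>2)) x = 0"
    using assms(2,3) by (intro DERIV_local_max[OF poly_DERIV]) (auto simp: abs_le_square_iff)
  then show ?thesis
    using assms(1) by (simp add: power2_eq_square pderiv_mult)
qed

lemma lobatto_ode_of_nodes: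
  fixes y :: "nat \<Rightarrow> real"
  assumes "r \<ge> 2" "inj_on y {..<r}"
  defines "w \<equiv> \<Prod>j<r. [:- y j, 1:]"
  assumes zero: "\<And>k. k < r \<Longrightarrow> y k = 1 \<or> y k = -1 \<or> poly (pderiv (pderiv w)) (y k) = 0"
  shows "[:1, 0, -1:] * pderiv (pderiv w) = Polynomial.smult (- (real r * (real r - 1))) w"
proof -
  note w = node_poly[of "{..<r}" y, folded w_def, simplified]
  define u where "u = [:1, 0, -1:] * pderiv (pderiv w) + Polynomial.smult (real r * (real r - 1)) w"
  \<comment> \<open>In degree \<open>r\<close> the two contributions of the leading coefficient of
    \<open>w\<close> cancel; above it all coefficients of \<open>w\<close> vanish.\<close>
  have "coeff u m = 0" if "m \<ge> r" for m
  proof (cases "m = r")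
    case False
    then have "coeff w m = 0" "coeff w (m + 2) = 0"
      using that w(1) by (auto intro: coeff_eq_0)
    then show ?thesis
      unfolding u_def coeff_add coeff_legendre_operator by simp
  next
    case True
    have "coeff w (r + 2) = 0"
      using w(1) by (auto intro: coeff_eq_0)
    with True show ?thesis
      unfolding u_def coeff_add coeff_legendre_operator by simp
  qed
  then have "degree u < r"
    using assms(1) by (metis degree_lessI zero_less_numeral order_less_le_trans)
  moreover have "poly u x = 0" if "x \<in> y ` {..<r}" for x
  proof -
    from that obtain k where k: "k < r" "x = y k" by auto
    then have "poly w x = 0" unfolding w(3) by auto
    moreover have "(1 - x * x) * poly (pderiv (pderiv w)) x = 0"
      using zero[OF k(1)] k(2) by auto
    ultimately show ?thesis
      by (simp add: u_def algebra_simps del: mult_pCons_left)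
  qed
  ultimately have "u = 0"
    using assms(1) by (intro poly_eqI_degree[of "y ` {..<r}"]) (auto simp: card_image[OF assms(2)])
  then show ?thesis
    by (simp add: u_def add_eq_0_iff del: mult_pCons_left)
qed

text \<open>\<open>sorted_list_of_set\<close> is increasing, hence the reverse of the list of the
  \<open>y i\<close>, and the reversal in \<open>lgl_node\<close> undoes this. Nodes are counted
  from 1 there and from 0 in \<open>y\<close>.\<close>

lemma lgl_node_eqI:
  assumes nodes: "lgl_nodes r = y ` {..<r}"
    and decr: "\<And>i j. i < j \<Longrightarrow> j < r \<Longrightarrow> y j < y i"
    and "i < r"
  shows "lgl_node r (Suc i) = y i"
proof -
  have inj: "inj_on y {..<r}"
    using decr by (rule inj_on_if_decreasing)
  have "sorted_wrt (<) (rev (map y [0..<r]))"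
    using decr by (auto simp: sorted_wrt_iff_nth_less rev_nth)
  moreover have "set (rev (map y [0..<r])) = lgl_nodes r"
    unfolding nodes by (auto simp: lessThan_atLeast0)
  moreover have "length (rev (map y [0..<r])) = card (lgl_nodes r)"
    unfolding nodes by (simp add: card_image[OF inj])
  ultimately have "sorted_list_of_set (lgl_nodes r) = rev (map y [0..<r])"
    by (metis List.finite_set sorted_list_of_set_unique)
  then show ?thesis
    using assms(3) by (simp add: lgl_node_def)
qed

text \<open>Maximality is assumed for one node at a time, and only for moves that keep the order;
  this already determines all the nodes.\<close>

lemma fekete_points_eq_lgl_node:
  fixes y :: "nat \<Rightarrow> real"
  assumes r: "r \<ge> 2"
    and decr: "\<And>i j. i < j \<Longrightarrow> j < r \<Longrightarrow> y j < y i"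
    and bnd: "\<And>i. i < r \<Longrightarrow> \<bar>y i\<bar> \<le> 1"
    and max: "\<And>k t. k < r \<Longrightarrow> \<bar>t\<bar> \<le> 1 \<Longrightarrow> (\<And>i. i < k \<Longrightarrow> t < y i) \<Longrightarrow>
      (\<And>i. k < i \<Longrightarrow> i < r \<Longrightarrow> y i < t) \<Longrightarrow>
      (\<Prod>j\<in>{..<r}-{k}. \<bar>t - y j\<bar>) \<le> (\<Prod>j\<in>{..<r}-{k}. \<bar>y k - y j\<bar>)"
    and "i < r"
  shows "lgl_node r (Suc i) = y i"
proof -
  \<comment> \<open>Moving the largest node to 1 would increase its distance to every other node;
    index 1 witnesses the strict increase of the product.\<close>
  have first: "y 0 = 1"
  proof (rule ccontr)
    assume "y 0 \<noteq> 1"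
    with bnd[of 0] r have y0: "y 0 < 1" by auto
    have "(\<Prod>j\<in>{..<r}-{0}. \<bar>y 0 - y j\<bar>) < (\<Prod>j\<in>{..<r}-{0}. \<bar>1 - y j\<bar>)"
    proof (rule prod_mono_strict[of 1])
      show "0 \<le> \<bar>y 0 - y i\<bar> \<and> \<bar>y 0 - y i\<bar> \<le> \<bar>1 - y i\<bar>" "0 < \<bar>1 - y i\<bar>" if "i \<in> {..<r}-{0}" for i
        using that decr[of 0 i] y0 by auto
    qed (use r decr[of 0 1] y0 in auto)
    moreover have "(\<Prod>j\<in>{..<r}-{0}. \<bar>1 - y j\<bar>) \<le> (\<Prod>j\<in>{..<r}-{0}. \<bar>y 0 - y j\<bar>)"
      using r decr[of 0] y0 by (intro max) (auto intro: order_less_trans)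
    ultimately show False by simp
  qed
  have last: "y (r - 1) = -1"
  proof (rule ccontr)
    assume "y (r - 1) \<noteq> -1"
    with bnd[of "r - 1"] r have yr: "-1 < y (r - 1)" by auto
    have lt: "y (r - 1) < y i" if "i < r" "i \<noteq> r - 1" for i
      using that decr[of i "r - 1"] by auto
    have "(\<Prod>j\<in>{..<r}-{r - 1}. \<bar>y (r - 1) - y j\<bar>) < (\<Prod>j\<in>{..<r}-{r - 1}. \<bar>-1 - y j\<bar>)"
    proof (rule prod_mono_strict[of 0])
      show "0 \<le> \<bar>y (r-1) - y i\<bar> \<and> \<bar>y (r-1) - y i\<bar> \<le> \<bar>-1 - y i\<bar>" "0 < \<bar>-1 - y i\<bar>"
        if "i \<in> {..<r}-{r-1}" for i
        using that lt[of i] yr by auto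
    qed (use r lt[of 0] yr in auto)
    moreover have "(\<Prod>j\<in>{..<r}-{r-1}. \<bar>-1 - y j\<bar>) \<le> (\<Prod>j\<in>{..<r}-{r-1}. \<bar>y (r-1) - y j\<bar>)"
      using r lt yr by (intro max) (auto intro: order_less_trans)
    ultimately show False by simp
  qed
  have inj: "inj_on y {..<r}"
    using decr by (rule inj_on_if_decreasing)
  define w where "w = (\<Prod>j<r. [:- y j, 1:])"
  \<comment> \<open>With \<open>w = (x - y k) F\<close> the second derivative at \<open>y k\<close>
    is \<open>2 F'(y k)\<close>, and \<open>\<bar>F\<bar>\<close> has a local maximum there.\<close>
  have "poly (pderiv (pderiv w)) (y k) = 0" if k: "0 < k" "k < r - 1" for k
  proof -
    define F where "F = (\<Prod>j\<in>{..<r}-{k}. [:- y j, 1:])"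
    have F: "poly F x = (\<Prod>j\<in>{..<r}-{k}. x - y j)" for x
      unfolding F_def by (rule node_poly) simp
    have w: "w = [:- y k, 1:] * F"
      unfolding w_def F_def using k by (intro prod.remove) auto
    have le: "y (k - 1) \<le> y i" if "i < k" for i
    proof (cases "i = k - 1")
      case False
      with that k have "i < k - 1" "k - 1 < r" by auto
      then show ?thesis using decr[of i "k - 1"] by simp
    qed simp
    have ge: "y i \<le> y (Suc k)" if "k < i" "i < r" for i
      using that decr[of "Suc k" i] by (cases "i = Suc k") auto
    \<comment> \<open>The distance to the nearer neighbour: a smaller move keeps the order and stays
      in \<open>[-1, 1]\<close>.\<close>
    define d where "d = min (y (k - 1) - y k) (y k - y (Suc k))"
    have "poly (pderiv F) (y k) = 0"
    proof (rule poly_local_max_abs_imp_critical)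
      show "poly F (y k) \<noteq> 0"
        using inj k by (auto simp: F inj_on_def)
      show "d > 0"
        using decr[of "k - 1" k] decr[of k "Suc k"] k by (simp add: d_def)
      fix t assume "\<bar>y k - t\<bar> < d"
      then have t: "y (Suc k) < t" "t < y (k - 1)"
        by (auto simp: d_def)
      moreover have "\<bar>y (Suc k)\<bar> \<le> 1" "\<bar>y (k - 1)\<bar> \<le> 1"
        using k by (auto intro!: bnd)
      ultimately have "\<bar>t\<bar> \<le> 1" by linarith
      then show "\<bar>poly F t\<bar> \<le> \<bar>poly F (y k)\<bar>"
        unfolding F abs_prod using k t le ge by (intro max) fastforce+
    qed
    then show ?thesis
      by (simp add: w pderiv_mult pderiv_add pderiv_pCons del: mult_pCons_left)
  qed
  then have zero: "y k = 1 \<or> y k = -1 \<or> poly (pderiv (pderiv w)) (y k) = 0" if "k < r" for k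
    using that first last by (cases "k = 0"; cases "k = r - 1") auto
  have "lgl_nodes r = {x. poly w x = 0}"
    using node_poly(2)[of "{..<r}" y] lobatto_ode_of_nodes[OF r inj] zero
    unfolding w_def[symmetric] by (intro lgl_nodes_eq_roots[OF r]) simp_all
  also have "\<dots> = y ` {..<r}"
    using node_poly(3)[of "{..<r}" y] unfolding w_def[symmetric] by auto
  finally show ?thesis
    using decr assms(5) by (intro lgl_node_eqI) auto
qed

subsection \<open>The Vandermonde matrix of arc segments\<close>

lemma degree_chebyshev_U: "degree (chebyshev_U n) = n"
proof (induction n rule: chebyshev_U.induct)
  case (3 n)
  then have "chebyshev_U (Suc n) \<noteq> 0" by auto
  then have "degree ([:0, 2:] * chebyshev_U (Suc n)) = Suc (Suc n)"
    using 3 by (subst degree_mult_eq) auto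
  then show ?case
    unfolding chebyshev_U.simps diff_conv_add_uminus using 3 by (subst degree_add_eq_left) auto
qed simp_all

text \<open>Midpoint and radius separate into factors, so the radius can later be absorbed into the
  polynomial basis.\<close>

lemma integral_chebyshev_U_arc_segment:
  assumes "0 \<le> \<tau> - \<rho>" "\<tau> + \<rho> \<le> pi" "0 \<le> \<rho>"
  shows "integral (arc_segment \<rho> \<tau>) (poly (chebyshev_U j))
    = 2 * sin (real (Suc j) * \<tau>) * sin (real (Suc j) * \<rho>) / real (Suc j)"
proof -
  define n where "n = real (Suc j)"
  have n: "n > 0" by (simp add: n_def)
  have mono: "cos (- (\<tau> + \<rho>)) \<le> cos (- (\<tau> - \<rho>))"
    unfolding cos_minus using assms by (intro cos_monotone_0_pi_le) auto
  \<comment> \<open>substituting \<open>cos (- t)\<close> keeps the change of variables increasing\<close>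
  have "((\<lambda>t. - sin t *\<^sub>R poly (chebyshev_U j) (cos t)) has_integral
      integral {cos (- (\<tau> + \<rho>))..cos (- (\<tau> - \<rho>))} (poly (chebyshev_U j))) {- (\<tau> + \<rho>)..- (\<tau> - \<rho>)}"
    using assms
    by (intro has_integral_substitution[where c = "-1" and d = 1] mono)
      (auto intro!: continuous_intros derivative_eq_intros)
  also have "(\<lambda>t. - sin t *\<^sub>R poly (chebyshev_U j) (cos t)) = (\<lambda>t. - sin (n * t))"
    unfolding n_def using chebyshev_U_cos[of j] by (auto simp: mult.commute)
  finally have 1: "((\<lambda>t. - sin (n * t)) has_integral
      integral (arc_segment \<rho> \<tau>) (poly (chebyshev_U j))) {- (\<tau> + \<rho>)..- (\<tau> - \<rho>)}"
    by (simp only: arc_segment_def cos_minus)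
  have "((\<lambda>t. - sin (n * t)) has_integral
      cos (n * (- (\<tau> - \<rho>))) / n - cos (n * (- (\<tau> + \<rho>))) / n) {- (\<tau> + \<rho>)..- (\<tau> - \<rho>)}"
    using assms n
    by (intro fundamental_theorem_of_calculus)
      (auto simp flip: has_real_derivative_iff_has_vector_derivative intro!: derivative_eq_intros)
  from has_integral_unique[OF 1 this]
  have "integral (arc_segment \<rho> \<tau>) (poly (chebyshev_U j))
      = (cos (n * \<tau> - n * \<rho>) - cos (n * \<tau> + n * \<rho>)) / n"
    by (simp add: diff_divide_distrib right_diff_distrib distrib_left flip: cos_minus[of "_ + _"])
      (metis cos_minus minus_diff_eq)
  then show ?thesis
    unfolding n_def cos_add cos_diff by simp
qed

lemma measure_arc_segment:
  assumes "0 \<le> \<tau> - \<rho>" "\<tau> + \<rho> \<le> pi" "0 \<le> \<rho>"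
  shows "measure lborel (arc_segment \<rho> \<tau>) = 2 * sin \<tau> * sin \<rho>"
proof -
  have "cos (\<tau> + \<rho>) \<le> cos (\<tau> - \<rho>)"
    using assms by (intro cos_monotone_0_pi_le) auto
  then show ?thesis
    by (simp add: arc_segment_def cos_add cos_diff)
qed

section \<open>Determinants of collocation matrices in a graded polynomial basis\<close>

lemma sum_smult_graded_eq_0:
  fixes p :: "nat \<Rightarrow> 'a :: field poly"
  assumes "\<And>j. j < r \<Longrightarrow> degree (p j) = j \<and> p j \<noteq> 0"
    and "(\<Sum>j<r. Polynomial.smult (a j) (p j)) = 0" and "j < r"
  shows "a j = 0"
  using assms
proof (induction r arbitrary: j)
  case (Suc r)
  \<comment> \<open>Only \<open>p r\<close> reaches degree \<open>r\<close>, so its factor vanishes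
    first and the induction descends to smaller degrees.\<close>
  have "coeff (\<Sum>j<r. Polynomial.smult (a j) (p j)) r = 0"
    unfolding coeff_sum using Suc.prems(1) by (auto intro!: sum.neutral coeff_eq_0)
  moreover have "coeff (p r) r \<noteq> 0"
    using Suc.prems(1)[of r] leading_coeff_0_iff[of "p r"] by auto
  ultimately have "a r = 0"
    using arg_cong[OF Suc.prems(2), of "\<lambda>p. coeff p r"] by simp
  with Suc.prems Suc.IH[of j] show ?case
    by (cases "j = r") auto
qed simp

text \<open>A generalised Vandermonde matrix: \<open>p j = x^j\<close> gives the classical one. The
  free choice of basis leaves room for the column factors that depend on the radius.\<close>

definition collocation_mat :: "nat \<Rightarrow> (nat \<Rightarrow> real poly) \<Rightarrow> (nat \<Rightarrow> real) \<Rightarrow> real mat" where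
  "collocation_mat r p x = mat r r (\<lambda>(i, j). poly (p j) (x i))"

lemma collocation_mat_carrier [simp]: "collocation_mat r p x \<in> carrier_mat r r"
  by (simp add: collocation_mat_def)

lemma degree_sum_smult_less:
  assumes "\<And>j. j < r \<Longrightarrow> degree (p j) < r" "r > 0"
  shows "degree (\<Sum>j<r. Polynomial.smult (a j) (p j)) < r"
  using assms by (intro degree_sum_less) (auto intro: order_le_less_trans[OF degree_smult_le])

text \<open>A kernel vector would list the coefficients of a polynomial of degree below
  \<open>r\<close> with \<open>r\<close> distinct zeros.\<close>

lemma det_collocation_mat_nonzero:
  assumes p: "\<And>j. j < r \<Longrightarrow> degree (p j) = j \<and> p j \<noteq> 0" and inj: "inj_on x {..<r}"
  shows "Determinant.det (collocation_mat r p x) \<noteq> 0"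
proof
  assume "Determinant.det (collocation_mat r p x) = 0"
  then obtain v where v: "v \<in> carrier_vec r" "v \<noteq> 0\<^sub>v r"
      "collocation_mat r p x *\<^sub>v v = 0\<^sub>v r"
    using det_0_iff_vec_prod_zero_field[of "collocation_mat r p x" r] by auto
  define P where "P = (\<Sum>j<r. Polynomial.smult (vec_index v j) (p j))"
  \<comment> \<open>In dimension 0 there is no nonzero vector \<open>v\<close>.\<close>
  have r: "r > 0"
    using v(1,2) by (metis eq_vecI carrier_vecD index_zero_vec(2) not_gr_zero not_less_zero)
  have "poly P (x i) = 0" if "i < r" for i
  proof -
    have "vec_index (collocation_mat r p x *\<^sub>v v) i = poly P (x i)"
      using that v(1)
      by (simp add: collocation_mat_def P_def poly_sum scalar_prod_def lessThan_atLeast0 mult.commute)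
    then show ?thesis
      using v(3) that by simp
  qed
  moreover have "degree P < r"
    unfolding P_def using p r by (intro degree_sum_smult_less) auto
  ultimately have "P = 0"
    using r by (intro poly_eqI_degree[of "x ` {..<r}"]) (auto simp: card_image[OF inj])
  then have "vec_index v j = 0" if "j < r" for j
    using sum_smult_graded_eq_0[OF p _ that, of "vec_index v"] by (simp add: P_def)
  with v(1,2) show False
    by (metis eq_vecI carrier_vecD index_zero_vec)
qed

text \<open>As a function of a single node the determinant is a polynomial of degree less than \<open>r\<close> that
  vanishes at the other nodes, which is all that is needed of the Vandermonde product formula.\<close>
lemma det_collocation_mat_update:
  assumes p: "\<And>j. j < r \<Longrightarrow> degree (p j) < r" and inj: "inj_on x {..<r}" and k: "k < r"
  shows "Determinant.det (collocation_mat r p (x(k := t))) * (\<Prod>j\<in>{..<r}-{k}. x k - x j)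
    = Determinant.det (collocation_mat r p x) * (\<Prod>j\<in>{..<r}-{k}. t - x j)"
proof -
  \<comment> \<open>Laplace expansion along row \<open>k\<close>: the cofactors do not involve node
    \<open>k\<close>, so \<open>P\<close> is the determinant as a function of that node.\<close>
  define P where "P = (\<Sum>j<r. Polynomial.smult (cofactor (collocation_mat r p x) k j) (p j))"
  have det: "Determinant.det (collocation_mat r p (x(k := s))) = poly P s" for s
  proof -
    have "mat_delete (collocation_mat r p (x(k := s))) k j = mat_delete (collocation_mat r p x) k j" for j
      using k by (auto simp: mat_delete_def collocation_mat_def intro!: cong_mat)
    then have "cofactor (collocation_mat r p (x(k := s))) k j = cofactor (collocation_mat r p x) k j" for j
      by (simp add: cofactor_def)
    then show ?thesis
      unfolding laplace_expansion_row[OF collocation_mat_carrier k, of p "x(k := s)"] P_def poly_sum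
      using k by (intro sum.cong) (simp_all add: collocation_mat_def mult.commute)
  qed
  define Q where "Q = (\<Prod>j\<in>{..<r}-{k}. [:- x j, 1:])"
  have Q: "poly Q s = (\<Prod>j\<in>{..<r}-{k}. s - x j)" for s
    by (simp add: Q_def poly_prod)
  \<comment> \<open>Both sides agree at \<open>x k\<close> by the choice of the factors; at the
    other nodes \<open>Q\<close> has a root and the determinant has two equal rows.\<close>
  have "Polynomial.smult (poly Q (x k)) P = Polynomial.smult (poly P (x k)) Q"
  proof (rule poly_eqI_degree[of "x ` {..<r}"])
    fix s assume "s \<in> x ` {..<r}"
    then obtain i where i: "i < r" "s = x i" by auto
    show "poly (Polynomial.smult (poly Q (x k)) P) s = poly (Polynomial.smult (poly P (x k)) Q) s"
    proof (cases "i = k")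
      case False
      then have "poly Q s = 0"
        using i by (auto simp: Q)
      moreover have "poly P s = 0"
        unfolding det[symmetric] using False i k
        by (intro det_identical_rows[OF collocation_mat_carrier, of i k])
          (auto simp: collocation_mat_def intro!: eq_vecI)
      ultimately show ?thesis by simp
    qed (simp add: i)
  next
    have "degree P < r"
      unfolding P_def using p k by (intro degree_sum_smult_less) auto
    then show "degree (Polynomial.smult (poly Q (x k)) P) < card (x ` {..<r})"
      by (auto simp: card_image[OF inj] intro: order_le_less_trans[OF degree_smult_le])
    have "degree Q = card ({..<r}-{k})"
      unfolding Q_def by (subst degree_prod_sum_eq) auto
    then show "degree (Polynomial.smult (poly P (x k)) Q) < card (x ` {..<r})"
      using k by (auto simp: card_image[OF inj] intro: order_le_less_trans[OF degree_smult_le])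
  qed
  from arg_cong[OF this, of "\<lambda>q. poly q t"] show ?thesis
    using det[of "x k"] by (simp add: det Q mult.commute)
qed

text \<open>Scaled so that its value at \<open>cos \<tau>\<close> is the average of
  \<open>chebyshev_U j\<close> over \<open>arc_segment \<rho> \<tau>\<close>.\<close>

definition arc_basis :: "real \<Rightarrow> nat \<Rightarrow> real poly" where
  "arc_basis \<rho> j =
    Polynomial.smult (sin (real (Suc j) * \<rho>) / (real (Suc j) * sin \<rho>)) (chebyshev_U j)"

text \<open>The upper bound on \<open>\<rho>\<close> keeps every angle
  \<open>(j + 1) * \<rho>\<close> strictly between 0 and \<open>pi\<close>, so no column factor
  vanishes.\<close>

lemma arc_basis_graded:
  assumes "0 < \<rho>" "\<rho> < pi / real r" "j < r"
  shows "degree (arc_basis \<rho> j) = j \<and> arc_basis \<rho> j \<noteq> 0"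
proof -
  have "real (Suc j) * \<rho> \<le> real r * \<rho>"
    using assms by (intro mult_right_mono) auto
  also have "\<dots> < pi"
    using assms by (simp add: field_simps)
  finally have lt: "real (Suc j) * \<rho> < pi" .
  moreover have "\<rho> \<le> real (Suc j) * \<rho>"
    using assms by (simp add: algebra_simps)
  ultimately have "sin \<rho> > 0"
    using assms by (intro sin_gt_zero) linarith+
  moreover have "sin (real (Suc j) * \<rho>) > 0"
    using assms lt by (intro sin_gt_zero mult_pos_pos) auto
  moreover have "chebyshev_U j \<noteq> 0"
    using degree_chebyshev_U[of j] by (cases j) auto
  ultimately show ?thesis
    by (simp add: arc_basis_def degree_chebyshev_U)
qed

lemma admissible_midpoints_bounds:
  assumes "admissible_midpoints r \<rho> \<tau>" "i \<in> {1..r}"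
  shows "\<rho> \<le> \<tau> i" "\<tau> i \<le> pi - \<rho>"
proof -
  have "mono_on {1..r} \<tau>"
    using assms(1) by (simp add: admissible_midpoints_def strict_mono_on_imp_mono_on)
  then have "\<tau> 1 \<le> \<tau> i" "\<tau> i \<le> \<tau> r"
    using assms(2) by (auto intro: mono_onD)
  then show "\<rho> \<le> \<tau> i" "\<tau> i \<le> pi - \<rho>"
    using assms(1) by (auto simp: admissible_midpoints_def)
qed

lemma normalized_vandermonde_arc_segments:
  assumes "admissible_midpoints r \<rho> \<tau>" "0 < \<rho>"
  shows "normalized_vandermonde r (\<lambda>i. arc_segment \<rho> (\<tau> i))
    = collocation_mat r (arc_basis \<rho>) (\<lambda>i. cos (\<tau> (Suc i)))"
  unfolding normalized_vandermonde_def collocation_mat_def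
proof (intro cong_mat refl, clarify)
  fix i j assume "i < r"
  define t where "t = \<tau> (Suc i)"
  have t: "\<rho> \<le> t" "t \<le> pi - \<rho>"
    using admissible_midpoints_bounds[OF assms(1), of "Suc i"] \<open>i < r\<close> by (auto simp: t_def)
  \<comment> \<open>The factor \<open>sin t\<close> occurs in both the length and the integral and
    is cancelled.\<close>
  then have "sin t > 0"
    using assms(2) by (intro sin_gt_zero) auto
  moreover have "measure lborel (arc_segment \<rho> t) = 2 * sin t * sin \<rho>"
    and "integral (arc_segment \<rho> t) (poly (chebyshev_U j))
      = 2 * sin (real (Suc j) * t) * sin (real (Suc j) * \<rho>) / real (Suc j)"
    using t assms(2) by (auto intro!: measure_arc_segment integral_chebyshev_U_arc_segment
      simp del: of_nat_Suc)
  moreover have "sin (real (Suc j) * t) = poly (chebyshev_U j) (cos t) * sin t"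
    by (rule chebyshev_U_cos[symmetric])
  ultimately show "1 / measure lborel (arc_segment \<rho> (\<tau> (Suc i)))
      * integral (arc_segment \<rho> (\<tau> (Suc i))) (poly (chebyshev_U j))
    = poly (arc_basis \<rho> j) (cos (\<tau> (Suc i)))"
    unfolding t_def[symmetric] by (simp add: arc_basis_def mult.commute del: of_nat_Suc)
qed

lemma admissible_midpoints_cos_less:
  assumes "admissible_midpoints r \<rho> \<tau>" "0 \<le> \<rho>"
  shows "i < j \<Longrightarrow> j < r \<Longrightarrow> cos (\<tau> (Suc j)) < cos (\<tau> (Suc i))"
proof -
  assume ij: "i < j" "j < r"
  then have "\<tau> (Suc i) < \<tau> (Suc j)"
    using assms(1) by (auto simp: admissible_midpoints_def intro: strict_mono_onD)
  then show ?thesis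
    using admissible_midpoints_bounds[OF assms(1), of "Suc i"]
      admissible_midpoints_bounds[OF assms(1), of "Suc j"] ij assms(2)
    by (intro cos_monotone_0_pi) auto
qed

text \<open>An expression in the angles that is continuous on all families and equals the original
  objective on the admissible ones.\<close>

definition fekete_objective :: "nat \<Rightarrow> real \<Rightarrow> (nat \<Rightarrow> real) \<Rightarrow> real" where
  "fekete_objective r \<rho> \<tau> =
    \<bar>Determinant.det (collocation_mat r (arc_basis \<rho>) (\<lambda>i. cos (\<tau> (Suc i))))\<bar>"

lemma fekete_segments_iff:
  assumes "0 < \<rho>"
  shows "fekete_segments r \<rho> \<tau> \<longleftrightarrow> admissible_midpoints r \<rho> \<tau> \<and>
    (\<forall>\<tau>'. admissible_midpoints r \<rho> \<tau>' \<longrightarrow> fekete_objective r \<rho> \<tau>' \<le> fekete_objective r \<rho> \<tau>)"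
  using normalized_vandermonde_arc_segments[of r \<rho>] assms
  by (auto simp: fekete_segments_def is_arg_max_def fekete_objective_def not_less)

lemma fekete_objective_pos:
  assumes "admissible_midpoints r \<rho> \<tau>" "0 < \<rho>" "\<rho> < pi / real r"
  shows "fekete_objective r \<rho> \<tau> > 0"
proof -
  have "inj_on (\<lambda>i. cos (\<tau> (Suc i))) {..<r}"
    using admissible_midpoints_cos_less[OF assms(1)] assms(2) by (intro inj_on_if_decreasing) auto
  then show ?thesis
    using det_collocation_mat_nonzero[of r "arc_basis \<rho>"] arc_basis_graded[OF assms(2,3)]
    by (simp add: fekete_objective_def)
qed

section \<open>Continuity and compactness in the product topology\<close>

lemma continuous_on_fekete_objective: "continuous_on A (fekete_objective r \<rho>)"
proof -
  \<comment> \<open>The entries of the matrix are given by \<open>poly\<close> only for indices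
    below \<open>r\<close>, so the permuted column index has to stay in range.\<close>
  have perm: "p i < r" if "p permutes {0..<r}" "i < r" for p and i :: nat
    using permutes_in_image[OF that(1), of i] that(2) by simp
  have "(\<lambda>\<tau>. \<bar>Determinant.det (collocation_mat r (arc_basis \<rho>) (\<lambda>i. cos (\<tau> (Suc i))))\<bar>)
      = (\<lambda>\<tau>. \<bar>\<Sum>p\<in>{p. p permutes {0..<r}}. signof p *
          (\<Prod>i = 0..<r. poly (arc_basis \<rho> (p i)) (cos (\<tau> (Suc i))))\<bar>)"
    unfolding det_def'[OF collocation_mat_carrier]
    by (intro ext arg_cong[of _ _ abs] sum.cong arg_cong2[of _ _ _ _ "(*)"] prod.cong refl)
      (auto simp: collocation_mat_def perm)
  then have "fekete_objective r \<rho> = \<dots>"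
    by (simp add: fekete_objective_def[abs_def])
  moreover have "continuous_on A (\<lambda>\<tau> :: nat \<Rightarrow> real. \<tau> i)" for i
    by (rule continuous_on_subset[OF continuous_on_product_coordinates]) simp
  ultimately show ?thesis
    by (auto intro!: continuous_intros)
qed

text \<open>Tychonoff's theorem, transferred from \<open>product_topology\<close> to the topology of
  the function type.\<close>

lemma compact_PiE_UNIV:
  fixes S :: "'a \<Rightarrow> 'b :: topological_space set"
  assumes "\<And>i. compact (S i)"
  shows "compact (PiE UNIV S)"
proof -
  have "compactin (product_topology (\<lambda>_. euclidean) UNIV) (PiE UNIV S)"
    using assms by (auto simp: compactin_PiE)
  then show ?thesis
    by (simp add: euclidean_product_topology)
qed

subsection \<open>Fekete segments\<close>

lemma arc_radius_less_pi_half: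
  assumes "r \<ge> 2" "\<rho> < pi / real r"
  shows "\<rho> < pi / 2"
proof -
  have "pi / real r \<le> pi / 2"
    using assms(1) by (intro divide_left_mono) auto
  with assms(2) show ?thesis by (rule order_less_le_trans)
qed

section \<open>Existence of Fekete segments\<close>

lemma exists_admissible_midpoints:
  assumes "r \<ge> 2" "\<rho> < pi / 2"
  shows "\<exists>\<tau>. admissible_midpoints r \<rho> \<tau>"
proof -
  \<comment> \<open>The spacing of \<open>r\<close> equidistant angles from \<open>\<rho>\<close> to
    \<open>pi - \<rho>\<close>.\<close>
  define c where "c = (pi - 2 * \<rho>) / real (r - 1)"
  have "c > 0"
    using assms by (simp add: c_def)
  moreover have "real (r - 1) * c = pi - 2 * \<rho>"
    using assms by (simp add: c_def)
  ultimately have "admissible_midpoints r \<rho> (\<lambda>i. \<rho> + real (i - 1) * c)"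
    unfolding admissible_midpoints_def by (auto intro!: strict_mono_onI)
  then show ?thesis by blast
qed

text \<open>The determinant vanishes when two midpoints coincide and is nonzero for admissible
  families. A maximizer over the weakly increasing families therefore increases strictly.\<close>

lemma exists_fekete_segments:
  assumes "r \<ge> 2" "0 < \<rho>" "\<rho> < pi / real r"
  shows "\<exists>\<tau>. fekete_segments r \<rho> \<tau>"
proof -
  \<comment> \<open>The midpoints are only required to be weakly increasing here, so that the set is compact;
    indices outside \<open>{1..r}\<close> are irrelevant and pinned to \<open>0\<close>.\<close>
  define K where "K = PiE UNIV (\<lambda>i. if i \<in> {1..r} then {\<rho>..pi - \<rho>} else {0}) \<inter>
    (\<Inter>i\<in>{1..r}. \<Inter>j\<in>{i..r}. {\<tau>. \<tau> i \<le> \<tau> j})"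
  have "closed (\<Inter>i\<in>{1..r}. \<Inter>j\<in>{i..r}. {\<tau> :: nat \<Rightarrow> real. \<tau> i \<le> \<tau> j})"
    by (intro closed_INT ballI closed_Collect_le continuous_on_product_coordinates)
  then have "compact K"
    unfolding K_def by (intro compact_Int_closed compact_PiE_UNIV) auto
  \<comment> \<open>Admissibility leaves the values outside \<open>{1..r}\<close> free. Setting them
    to 0 moves the family into \<open>K\<close> and does not change the determinant.\<close>
  define clip where "clip = (\<lambda>\<tau> i. if i \<in> {1..r} then \<tau> i else 0 :: real)"
  have clip: "clip \<tau> \<in> K" "fekete_objective r \<rho> (clip \<tau>) = fekete_objective r \<rho> \<tau>"
    if "admissible_midpoints r \<rho> \<tau>" for \<tau>
  proof -
    have "mono_on {1..r} \<tau>"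
      using that by (simp add: admissible_midpoints_def strict_mono_on_imp_mono_on)
    then show "clip \<tau> \<in> K"
      using admissible_midpoints_bounds[OF that] by (auto simp: K_def clip_def mono_on_def)
    have "collocation_mat r p (\<lambda>i. cos (clip \<tau> (Suc i))) = collocation_mat r p (\<lambda>i. cos (\<tau> (Suc i)))" for p
      by (auto simp: collocation_mat_def clip_def intro!: cong_mat)
    then show "fekete_objective r \<rho> (clip \<tau>) = fekete_objective r \<rho> \<tau>"
      by (simp add: fekete_objective_def)
  qed
  obtain \<tau>' where \<tau>': "admissible_midpoints r \<rho> \<tau>'"
    using exists_admissible_midpoints arc_radius_less_pi_half[OF assms(1,3)] assms(1) by blast
  then obtain \<tau> where \<tau>: "\<tau> \<in> K" "\<And>\<sigma>. \<sigma> \<in> K \<Longrightarrow> fekete_objective r \<rho> \<sigma> \<le> fekete_objective r \<rho> \<tau>"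
    using continuous_attains_sup[OF \<open>compact K\<close> _ continuous_on_fekete_objective] clip by blast
  have pos: "fekete_objective r \<rho> \<tau> > 0"
    using fekete_objective_pos[OF \<tau>' assms(2,3)] clip[OF \<tau>'] \<tau>(2) by force
  have "\<tau> i < \<tau> j" if ij: "i \<in> {1..r}" "j \<in> {1..r}" "i < j" for i j
  proof -
    have "\<tau> i \<noteq> \<tau> j"
    proof
      assume "\<tau> i = \<tau> j"
      then have "Determinant.det (collocation_mat r (arc_basis \<rho>) (\<lambda>i. cos (\<tau> (Suc i)))) = 0"
        using ij by (intro det_identical_rows[OF collocation_mat_carrier, of "i - 1" "j - 1"])
          (auto simp: collocation_mat_def intro!: eq_vecI)
      with pos show False
        by (simp add: fekete_objective_def)
    qed
    then show ?thesis
      using \<tau>(1) ij by (auto simp: K_def less_le)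
  qed
  moreover have "\<rho> \<le> \<tau> 1" "\<tau> r \<le> pi - \<rho>"
    using \<tau>(1) assms(1) by (auto simp: K_def PiE_def Pi_def split: if_splits)
  ultimately have "admissible_midpoints r \<rho> \<tau>"
    by (auto simp: admissible_midpoints_def intro!: strict_mono_onI)
  then show ?thesis
    using fekete_segments_iff[OF assms(2)] \<tau>(2) clip by metis
qed

section \<open>Optimality under moves of a single midpoint\<close>

lemma fekete_segments_prod_le:
  assumes "fekete_segments r \<rho> \<tau>" "0 < \<rho>" "\<rho> < pi / real r"
    and k: "k < r" and \<sigma>: "admissible_midpoints r \<rho> (\<tau>(Suc k := s))"
  defines "x \<equiv> \<lambda>i. cos (\<tau> (Suc i))"
  shows "(\<Prod>j\<in>{..<r}-{k}. \<bar>cos s - x j\<bar>) \<le> (\<Prod>j\<in>{..<r}-{k}. \<bar>x k - x j\<bar>)"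
proof -
  have adm: "admissible_midpoints r \<rho> \<tau>"
    and le: "fekete_objective r \<rho> (\<tau>(Suc k := s)) \<le> fekete_objective r \<rho> \<tau>"
    using assms(1) \<sigma> by (auto simp: fekete_segments_iff[OF assms(2)])
  have inj: "inj_on x {..<r}"
    unfolding x_def using admissible_midpoints_cos_less[OF adm] assms(2) by (intro inj_on_if_decreasing) auto
  let ?D = "\<lambda>x. \<bar>Determinant.det (collocation_mat r (arc_basis \<rho>) x)\<bar>"
  have "(\<lambda>i. cos ((\<tau>(Suc k := s)) (Suc i))) = x(k := cos s)"
    by (auto simp: x_def)
  then have D: "?D (x(k := cos s)) \<le> ?D x" "?D x > 0"
    using le fekete_objective_pos[OF adm assms(2,3)] by (simp_all add: fekete_objective_def x_def)
  \<comment> \<open>The determinant and the product of distances change by the same ratio; the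
    positive optimal value \<open>?D x\<close> cancels at the end.\<close>
  have "?D x * (\<Prod>j\<in>{..<r}-{k}. \<bar>cos s - x j\<bar>) = ?D (x(k := cos s)) * (\<Prod>j\<in>{..<r}-{k}. \<bar>x k - x j\<bar>)"
    using det_collocation_mat_update[of r "arc_basis \<rho>" x k "cos s"] arc_basis_graded[OF assms(2,3)] inj k
    unfolding abs_prod[symmetric] abs_mult[symmetric] by simp
  also have "\<dots> \<le> ?D x * (\<Prod>j\<in>{..<r}-{k}. \<bar>x k - x j\<bar>)"
    using D(1) by (intro mult_right_mono prod_nonneg) auto
  finally show ?thesis
    using D(2) by simp
qed

lemma fekete_segments_midpoints:
  assumes r: "r \<ge> 2" and \<rho>: "0 < \<rho>" "\<rho> < pi / real r" and fek: "fekete_segments r \<rho> \<tau>" and "i < r"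
  shows "cos (\<tau> (Suc i)) = lgl_node r (Suc i) * cos \<rho>"
proof -
  have adm: "admissible_midpoints r \<rho> \<tau>"
    using fek by (simp add: fekete_segments_iff[OF \<rho>(1)])
  note bounds = admissible_midpoints_bounds[OF adm]
  define c where "c = cos \<rho>"
  have \<rho>2: "\<rho> < pi / 2"
    using r \<rho>(2) by (rule arc_radius_less_pi_half)
  with \<rho> have c: "c > 0"
    unfolding c_def by (intro cos_gt_zero)
  \<comment> \<open>Rescaling maps \<open>[- cos \<rho>, cos \<rho>]\<close> onto
    \<open>[-1, 1]\<close>.\<close>
  define y where "y = (\<lambda>i. cos (\<tau> (Suc i)) / c)"
  have "lgl_node r (Suc i) = y i"
  proof (rule fekete_points_eq_lgl_node[OF r _ _ _ \<open>i < r\<close>])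
    fix i assume i: "i < r"
    have \<tau>i: "\<rho> \<le> \<tau> (Suc i)" "\<tau> (Suc i) \<le> pi - \<rho>"
      using bounds[of "Suc i"] i by auto
    have "cos (\<tau> (Suc i)) \<le> cos \<rho>"
      using \<tau>i \<rho> by (intro cos_monotone_0_pi_le) auto
    moreover have "cos (pi - \<rho>) \<le> cos (\<tau> (Suc i))"
      using \<tau>i \<rho> by (intro cos_monotone_0_pi_le) auto
    ultimately show "\<bar>y i\<bar> \<le> 1"
      using c by (auto simp: y_def c_def abs_le_iff field_simps)
  next
    fix k t
    assume k: "k < r" and t: "\<bar>t\<bar> \<le> 1" "\<And>i. i < k \<Longrightarrow> t < y i" "\<And>i. k < i \<Longrightarrow> i < r \<Longrightarrow> y i < t"
    \<comment> \<open>The angle whose rescaled cosine is the trial point \<open>t\<close>; replacing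
      \<open>\<tau> (Suc k)\<close> by it has to give an admissible family.\<close>
    define s where "s = arccos (t * c)"
    have tc: "\<bar>t * c\<bar> \<le> c"
      using t(1) c by (simp add: abs_mult)
    also have "c \<le> 1" by (simp add: c_def)
    finally have "-1 \<le> t * c" "t * c \<le> 1" by (auto simp: abs_le_iff)
    then have s: "cos s = t * c" "0 \<le> s" "s \<le> pi"
      by (auto simp: s_def arccos_lbound arccos_ubound)
    have less: "a < b" if "cos b < cos a" "0 \<le> b" "a \<le> pi" for a b :: real
      using that cos_monotone_0_pi_le[of b a] by force
    have le: "a \<le> b" if "cos b \<le> cos a" "0 \<le> b" "a \<le> pi" for a b :: real
      using that cos_monotone_0_pi[of b a] by force
    have "cos s \<le> cos \<rho>" "cos (pi - \<rho>) \<le> cos s"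
      using tc by (auto simp: s c_def abs_le_iff)
    then have s_bounds: "\<rho> \<le> s" "s \<le> pi - \<rho>"
      using s \<rho> \<rho>2 by - (rule le; simp)+
    have before: "\<tau> (Suc i) < s" if "i < k" for i
    proof (rule less)
      show "cos s < cos (\<tau> (Suc i))"
        using t(2)[OF that] c by (simp add: s y_def pos_less_divide_eq)
    qed (use s bounds(2)[of "Suc i"] that k \<rho> in auto)
    have after: "s < \<tau> (Suc i)" if "k < i" "i < r" for i
    proof (rule less)
      show "cos (\<tau> (Suc i)) < cos s"
        using t(3)[OF that] c by (simp add: s y_def pos_divide_less_eq)
    qed (use s bounds(1)[of "Suc i"] that \<rho> in auto)
    have "(\<tau>(Suc k := s)) i < (\<tau>(Suc k := s)) j" if ij: "i \<in> {1..r}" "j \<in> {1..r}" "i < j" for i j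
    proof -
      have "i = Suc k \<Longrightarrow> s < \<tau> j"
        using after[of "j - 1"] ij by simp
      moreover have "j = Suc k \<Longrightarrow> \<tau> i < s"
        using before[of "i - 1"] ij by simp
      moreover have "\<tau> i < \<tau> j"
        using adm ij unfolding admissible_midpoints_def by (blast dest: strict_mono_onD)
      ultimately show ?thesis
        using ij by simp
    qed
    then have "admissible_midpoints r \<rho> (\<tau>(Suc k := s))"
      using s_bounds adm by (auto simp: admissible_midpoints_def intro!: strict_mono_onI)
    from fekete_segments_prod_le[OF fek \<rho> k this]
    have "(\<Prod>j\<in>{..<r}-{k}. \<bar>t * c - y j * c\<bar>) \<le> (\<Prod>j\<in>{..<r}-{k}. \<bar>y k * c - y j * c\<bar>)"
      using c by (simp add: s y_def)
    \<comment> \<open>Undoing the scaling costs the same power of \<open>c\<close> on both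
      sides.\<close>
    moreover have "(\<Prod>j\<in>{..<r}-{k}. \<bar>a * c - y j * c\<bar>)
        = (\<Prod>j\<in>{..<r}-{k}. \<bar>a - y j\<bar>) * c ^ card ({..<r}-{k})" for a
      unfolding left_diff_distrib[symmetric] abs_mult prod.distrib using c by simp
    ultimately show "(\<Prod>j\<in>{..<r}-{k}. \<bar>t - y j\<bar>) \<le> (\<Prod>j\<in>{..<r}-{k}. \<bar>y k - y j\<bar>)"
      using c by (simp only: mult_le_cancel_right_pos zero_less_power)
  next
    show "y j < y i" if "i < j" "j < r" for i j
      unfolding y_def using admissible_midpoints_cos_less[OF adm _ that] \<rho> c
      by (intro divide_strict_right_mono) auto
  qed
  then show ?thesis
    using c by (simp add: y_def c_def)
qed

text \<open>Existence keeps the characterisation from being vacuous. Cosine is injective on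
  \<open>[0, pi]\<close>, so the cosines also determine the Fekete segments uniquely.\<close>

theorem proposition17:
  fixes r :: nat and \<rho> :: real
  assumes "r \<ge> 2" and "0 < \<rho>" and "\<rho> < pi / real r"
  shows "(\<exists>\<tau>. fekete_segments r \<rho> \<tau>) \<and>
    (\<forall>\<tau>. fekete_segments r \<rho> \<tau> \<longrightarrow> (\<forall>i\<in>{1..r}. cos (\<tau> i) = lgl_node r i * cos \<rho>))"
proof (intro conjI allI impI ballI)
  show "\<exists>\<tau>. fekete_segments r \<rho> \<tau>"
    using assms by (rule exists_fekete_segments)
next
  fix \<tau> i assume "fekete_segments r \<rho> \<tau>" "i \<in> {1..r}"
  then show "cos (\<tau> i) = lgl_node r i * cos \<rho>"
    using fekete_segments_midpoints[OF assms, of \<tau> "i - 1"] by (cases i) auto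
qed

end
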